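(* Let $\rho:\mathbb Z^+\to[0,1]$, $n\mapsto\rho_n$, be an arbitrary function, where $\mathbb Z^+=\{1,2,3,\dots\}$, and let $Y\subset\mathbb Z^+$ be the random set in which each $n\in\mathbb Z^+$ is, independently of the others, included with probability $\rho_n$ (general step Bernoulli initial condition). Let $k\ge1$ and let $\xi_1,\dots,\xi_k\in\mathcal C_R$. Then $$\mathbb E\left[\ \sum_{S\subset Y,\ |S|=k}\tau^{\sigma(S,Y)}\prod_{i=1}^k\xi_i^{-s_i}\right]=\tau^{k(k+1)/2}\;(1\ 0\ 0\ \cdots)\ \mathcal B_1\mathcal B_2\cdots\mathcal B_k\begin{pmatrix}1\\ 1\\ \vdots\end{pmatrix},$$ where $\mathbb E$ is the average over $Y$, $S=\{s_1<s_2<\cdots<s_k\}$, and the quantities $\tau$, $\sigma(S,Y)$, $\mathcal C_R$ and the semi-infinite matrices $\mathcal B_i$ are as defined in the context.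
   Context: Let $p,q\ge 0$ with $p+q=1$ and $q\neq0$, and $\tau=p/q$. For sets of integers $U,V$, $\sigma(U,V)=\#\{(u,v):u\in U,\ v\in V,\ u\ge v\}$. $\mathcal C_R$ is the circle with center $0$ and radius $R$, where $R$ is assumed so large that $p+q\xi\xi'-\xi\ne0$ for all complex $\xi,\xi'$ with $|\xi|\ge R$, $|\xi'|\ge R$. For $1\le i\le k$ and $n\in\mathbb Z^+$ let $\varphi(i,n)=1-\rho_n+\rho_n\,\tau^{k-i+1}$. The semi-infinite matrix $\mathcal B_i$ has entries, with indices $0\le\mu,\nu<\infty$, $$B_{i,\mu,\nu}=\begin{cases}\xi_i^{-\nu}\,\rho_\nu\prod_{n=\mu+1}^{\nu-1}\varphi(i,n)&\text{if }\mu<\nu,\\[4pt] 0&\text{if }\mu\ge\nu,\end{cases}$$ where empty products equal $1$. The expression $(1\ 0\ 0\ \cdots)\,\mathcal B_1\cdots\mathcal B_k\,(1\ 1\ \cdots)^{T}$ is the sum of the entries of the top row (row index $0$) of the matrix product, lower-index matrices on the left, i.e. $\sum_{s_1,\dots,s_k=0}^\infty B_{1,0,s_1}B_{2,s_1,s_2}\cdots B_{k,s_{k-1},s_k}$. *)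

theory Defs
  imports "HOL-Probability.Probability"
begin

definition sigma_count :: "'a::linorder set \<Rightarrow> 'a set \<Rightarrow> nat" where
  "sigma_count U V = card {(u, v). u \<in> U \<and> v \<in> V \<and> u \<ge> v}"

text \<open>The positive integers are the positive elements of \<^typ>\<open>nat\<close>; \<open>\<rho> 0\<close> is never used.\<close>

definition bernoulli_random_set :: "'w measure \<Rightarrow> (nat \<Rightarrow> real) \<Rightarrow> ('w \<Rightarrow> nat set) \<Rightarrow> bool" where
  "bernoulli_random_set M \<rho> Y \<longleftrightarrow>
     prob_space M \<and>
     (\<forall>\<omega>\<in>space M. Y \<omega> \<subseteq> {1..}) \<and>
     prob_space.indep_events M (\<lambda>n. {\<omega> \<in> space M. n \<in> Y \<omega>}) {1..} \<and>
     (\<forall>n\<ge>1. measure M {\<omega> \<in> space M. n \<in> Y \<omega>} = \<rho> n)"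

text \<open>The \<open>i\<close>-th smallest element of a finite set, counting from \<open>i = 1\<close>.\<close>

definition nth_smallest :: "nat set \<Rightarrow> nat \<Rightarrow> nat" where
  "nth_smallest S i = sorted_list_of_set S ! (i - 1)"

definition subset_term :: "real \<Rightarrow> nat \<Rightarrow> (nat \<Rightarrow> complex) \<Rightarrow> nat set \<Rightarrow> nat set \<Rightarrow> complex" where
  "subset_term \<tau> k \<xi> Y S =
     complex_of_real \<tau> ^ sigma_count S Y * (\<Prod>i=1..k. \<xi> i powi (- int (nth_smallest S i)))"

definition k_subsets :: "nat \<Rightarrow> 'a set \<Rightarrow> 'a set set" where
  "k_subsets k Y = {S. S \<subseteq> Y \<and> finite S \<and> card S = k}"

definition phi :: "real \<Rightarrow> nat \<Rightarrow> (nat \<Rightarrow> real) \<Rightarrow> nat \<Rightarrow> nat \<Rightarrow> real" where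
  "phi \<tau> k \<rho> i n = 1 - \<rho> n + \<rho> n * \<tau> ^ (k - i + 1)"

type_synonym semi_inf_matrix = "nat \<Rightarrow> nat \<Rightarrow> complex"

definition B_mat ::
  "real \<Rightarrow> nat \<Rightarrow> (nat \<Rightarrow> real) \<Rightarrow> (nat \<Rightarrow> complex) \<Rightarrow> nat \<Rightarrow> semi_inf_matrix" where
  "B_mat \<tau> k \<rho> \<xi> i \<mu> \<nu> =
     (if \<mu> < \<nu>
      then \<xi> i powi (- int \<nu>) * complex_of_real (\<rho> \<nu>) *
           complex_of_real (\<Prod>n\<in>{\<mu><..<\<nu>}. phi \<tau> k \<rho> i n)
      else 0)"

text \<open>
  For the upper triangular matrices considered here every entry of a product is a sum with
  finitely many nonzero terms.
\<close>

definition semi_inf_mult :: "semi_inf_matrix \<Rightarrow> semi_inf_matrix \<Rightarrow> semi_inf_matrix" where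
  "semi_inf_mult A B \<mu> \<nu> = (\<Sum>\<^sub>\<infinity>\<kappa>. A \<mu> \<kappa> * B \<kappa> \<nu>)"

definition semi_inf_id :: semi_inf_matrix where
  "semi_inf_id \<mu> \<nu> = (if \<mu> = \<nu> then 1 else 0)"

text \<open>The product \<open>A 1 \<cdots> A k\<close>, with lower indices on the left.\<close>

definition semi_inf_prod :: "nat \<Rightarrow> (nat \<Rightarrow> semi_inf_matrix) \<Rightarrow> semi_inf_matrix" where
  "semi_inf_prod k A = foldr semi_inf_mult (map A [1..<k + 1]) semi_inf_id"

end

theory Submission
  imports Defs
begin

text \<open>
  Write \<open>c(n)\<close> for the number of \<open>s \<in> S\<close> with \<open>n \<le> s\<close>. For \<open>S \<subseteq> Y\<close>, \<open>\<tau> ^ \<sigma>(S, Y)\<close> is the product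
  of \<open>\<tau> ^ c(n)\<close> over \<open>n \<in> Y\<close>, so by independence the expectation of the term of \<open>S\<close> is a product
  over \<open>n \<le> max S\<close>, with factors \<open>\<rho> n * \<tau> ^ c(n)\<close> for \<open>n \<in> S\<close> and \<open>1 - \<rho> n + \<rho> n * \<tau> ^ c(n)\<close>
  otherwise. The powers of \<open>\<tau>\<close> from \<open>n \<in> S\<close> multiply to \<open>\<tau> ^ (k * (k + 1) div 2)\<close>; what
  remains is the product of matrix entries along the path \<open>0 < s\<^sub>1 < \<dots> < s\<^sub>k\<close>. The condition on
  \<open>R\<close> forces \<open>R > 1 + \<tau>\<close>, hence every term is dominated by the product of \<open>(max 1 \<tau> / R) ^ s\<close> over
  \<open>s \<in> S\<close>, uniformly in \<open>Y\<close>, and dominated convergence applies to the truncations \<open>S \<subseteq> {1..N}\<close>.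
\<close>

section \<open>Counting the elements of a finite set at or above a point\<close>

definition tail_count :: "'a::linorder set \<Rightarrow> 'a \<Rightarrow> nat" where
  "tail_count S n = card {s \<in> S. n \<le> s}"

lemma tail_count_empty [simp]: "tail_count {} n = 0"
  by (simp add: tail_count_def)

lemma tail_count_insert_le:
  assumes "finite S" "\<And>s. s \<in> S \<Longrightarrow> b < s" "n \<le> b"
  shows "tail_count (insert b S) n = Suc (card S)"
proof -
  have "{s \<in> insert b S. n \<le> s} = insert b S" "b \<notin> S"
    using assms by force+
  then show ?thesis
    using assms by (simp add: tail_count_def)
qed

lemma tail_count_insert_greater:
  assumes "b < n"
  shows "tail_count (insert b S) n = tail_count S n"
proof -
  have "{s \<in> insert b S. n \<le> s} = {s \<in> S. n \<le> s}"
    using assms by auto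
  then show ?thesis
    by (simp add: tail_count_def)
qed

text \<open>The tail counts along a set of \<open>k\<close> elements are \<open>k\<close>, ...,
  \<open>1\<close>. Their sum is the exponent of \<open>\<tau>\<close> in front of the matrix
  product.\<close>

lemma sum_tail_count:
  assumes "finite S"
  shows "(\<Sum>s\<in>S. tail_count S s) = card S * (card S + 1) div 2"
  using assms
proof (induction S rule: finite_linorder_min_induct)
  case (insert b A)
  have "b \<notin> A" using insert by auto
  have "(\<Sum>s\<in>A. tail_count (insert b A) s) = (\<Sum>s\<in>A. tail_count A s)"
    by (rule sum.cong) (use insert in \<open>auto simp: tail_count_insert_greater\<close>)
  then show ?case
    using insert \<open>b \<notin> A\<close> tail_count_insert_le[of A b b] by simp
qed simp

text \<open>The entry at zero-based position \<open>i\<close> has \<open>card S - i\<close> elements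
  at or above it, so the position can be read off from the tail count. \<open>g\<close> varies in
  the induction because removing the minimum shifts all positions by one.\<close>

lemma prod_sorted_list_of_set:
  fixes g :: "nat \<Rightarrow> 'a::linorder \<Rightarrow> 'b::comm_monoid_mult"
  assumes "finite S"
  shows "(\<Prod>i<card S. g i (sorted_list_of_set S ! i)) = (\<Prod>s\<in>S. g (card S - tail_count S s) s)"
  using assms
proof (induction S arbitrary: g rule: finite_linorder_min_induct)
  case (insert b A)
  have b: "b \<notin> A" using insert by auto
  have le: "tail_count A s \<le> card A" for s
    using insert by (auto simp: tail_count_def intro: card_mono)
  have "Min (insert b A) = b"
    using insert by (intro Min_eqI) auto
  then have list: "sorted_list_of_set (insert b A) = b # sorted_list_of_set A"
    using insert b by (simp add: sorted_list_of_set_nonempty)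
  have "(\<Prod>s\<in>A. g (Suc (card A) - tail_count (insert b A) s) s)
      = (\<Prod>s\<in>A. g (Suc (card A - tail_count A s)) s)"
    by (rule prod.cong) (use insert le in \<open>auto simp: tail_count_insert_greater Suc_diff_le\<close>)
  also have "\<dots> = (\<Prod>i<card A. g (Suc i) (sorted_list_of_set A ! i))"
    by (rule insert.IH[symmetric])
  finally show ?case
    using insert b tail_count_insert_le[of A b b] list
    by (simp add: prod.lessThan_Suc_shift del: prod.lessThan_Suc)
qed simp

text \<open>The one-based rank of \<open>s\<close> is \<open>k + 1 - tail_count S s\<close>. In this
  form \<open>\<xi> i\<close> becomes a factor attached to an element of \<open>S\<close>, just like
  the powers of \<open>\<tau>\<close>.\<close>

lemma prod_nth_smallest:
  fixes g :: "nat \<Rightarrow> nat \<Rightarrow> 'b::comm_monoid_mult"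
  assumes "finite S" "card S = k"
  shows "(\<Prod>i=1..k. g i (nth_smallest S i)) = (\<Prod>s\<in>S. g (k + 1 - tail_count S s) s)"
proof -
  have "(\<Prod>i=1..k. g i (nth_smallest S i)) = (\<Prod>i<k. g (Suc i) (sorted_list_of_set S ! i))"
    by (rule prod.reindex_bij_witness[of _ Suc "\<lambda>i. i - 1"]) (auto simp: nth_smallest_def)
  also have "\<dots> = (\<Prod>s\<in>S. g (Suc (k - tail_count S s)) s)"
    using prod_sorted_list_of_set[OF assms(1), of "\<lambda>i. g (Suc i)"] assms(2) by simp
  also have "\<dots> = (\<Prod>s\<in>S. g (k + 1 - tail_count S s) s)"
  proof (rule prod.cong)
    fix s
    have "tail_count S s \<le> k"
      using assms by (auto simp: tail_count_def intro: card_mono)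
    then show "g (Suc (k - tail_count S s)) s = g (k + 1 - tail_count S s) s"
      by (simp add: Suc_diff_le)
  qed simp
  finally show ?thesis .
qed

section \<open>Subsets of an interval, split at their minimum\<close>

lemma finite_k_subsets: "finite A \<Longrightarrow> finite (k_subsets k A)"
  by (rule finite_subset[of _ "Pow A"]) (auto simp: k_subsets_def)

lemma k_subsets_0 [simp]: "k_subsets 0 A = {{}}"
  by (auto simp: k_subsets_def)

text \<open>\<open>S\<close> corresponds to the pair of \<open>Min S\<close> and
  \<open>S - {Min S}\<close>. The outer sum over \<open>\<kappa>\<close> plays the role of the inner
  index of a matrix product.\<close>

lemma sum_k_subsets_Suc:
  fixes f :: "nat set \<Rightarrow> 'b::comm_monoid_add"
  shows "(\<Sum>S\<in>k_subsets (Suc m) {\<mu><..N}. f S)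
       = (\<Sum>\<kappa>\<in>{\<mu><..N}. \<Sum>S\<in>k_subsets m {\<kappa><..N}. f (insert \<kappa> S))"
proof -
  have "(\<Sum>\<kappa>\<in>{\<mu><..N}. \<Sum>S\<in>k_subsets m {\<kappa><..N}. f (insert \<kappa> S))
      = (\<Sum>(\<kappa>, S)\<in>(SIGMA \<kappa>:{\<mu><..N}. k_subsets m {\<kappa><..N}). f (insert \<kappa> S))"
    by (rule sum.Sigma) (auto intro: finite_k_subsets)
  also have "\<dots> = (\<Sum>S\<in>k_subsets (Suc m) {\<mu><..N}. f S)"
  proof (rule sum.reindex_bij_witness[of _ "\<lambda>S. (Min S, S - {Min S})" "\<lambda>(\<kappa>, S). insert \<kappa> S"])
    fix a assume "a \<in> (SIGMA \<kappa>:{\<mu><..N}. k_subsets m {\<kappa><..N})"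
    then obtain \<kappa> S where a: "a = (\<kappa>, S)" "\<mu> < \<kappa>" "\<kappa> \<le> N" "S \<subseteq> {\<kappa><..N}" "finite S" "card S = m"
      by (auto simp: k_subsets_def)
    then have "Min (insert \<kappa> S) = \<kappa>" "\<kappa> \<notin> S"
      by (auto intro!: Min_eqI)
    with a show "(Min (case a of (\<kappa>, S) \<Rightarrow> insert \<kappa> S),
        (case a of (\<kappa>, S) \<Rightarrow> insert \<kappa> S) - {Min (case a of (\<kappa>, S) \<Rightarrow> insert \<kappa> S)}) = a"
      and "(case a of (\<kappa>, S) \<Rightarrow> insert \<kappa> S) \<in> k_subsets (Suc m) {\<mu><..N}"
      by (auto simp: k_subsets_def)
  next
    fix S assume "S \<in> k_subsets (Suc m) {\<mu><..N}"
    then have S: "S \<subseteq> {\<mu><..N}" "finite S" "card S = Suc m"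
      by (auto simp: k_subsets_def)
    then have min: "Min S \<in> S" by (metis Min_in card.empty nat.distinct(1))
    then show "(case (Min S, S - {Min S}) of (\<kappa>, S) \<Rightarrow> insert \<kappa> S) = S"
      by auto
    have "Min S < s" if "s \<in> S - {Min S}" for s
      using that S(2) by (metis DiffD1 DiffD2 Min_le insertI1 order_le_imp_less_or_eq)
    then have "S - {Min S} \<subseteq> {Min S<..N}"
      using S(1) by fastforce
    with S min show "(Min S, S - {Min S}) \<in> (SIGMA \<kappa>:{\<mu><..N}. k_subsets m {\<kappa><..N})"
      by (auto simp: k_subsets_def)
  qed auto
  finally show ?thesis by simp
qed

text \<open>The first argument of \<open>x\<close> and \<open>y\<close> is the number
  \<open>c\<close> of elements of \<open>S\<close> at or above the position; for
  \<open>c > 0\<close> it will select the matrix with index \<open>k + 1 - c\<close>.\<close>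

definition subset_weight ::
  "(nat \<Rightarrow> nat \<Rightarrow> 'b) \<Rightarrow> (nat \<Rightarrow> nat \<Rightarrow> 'b) \<Rightarrow> nat set \<Rightarrow> nat set \<Rightarrow> 'b::comm_monoid_mult" where
  "subset_weight x y I S =
     (\<Prod>n\<in>I. if n \<in> S then x (tail_count S n) n else y (tail_count S n) n)"

text \<open>Every position up to \<open>\<kappa>\<close> sees all \<open>m + 1\<close> elements, and
  positions above \<open>\<kappa>\<close> do not see \<open>\<kappa>\<close>. So the part up to
  \<open>\<kappa>\<close> has the form of one matrix entry, and the rest is the weight of
  \<open>S\<close> in a shorter interval.\<close>

lemma subset_weight_insert_min:
  assumes "\<kappa> \<in> {\<mu><..N}" "S \<in> k_subsets m {\<kappa><..N}"
  shows "subset_weight x y {\<mu><..N} (insert \<kappa> S)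
       = (\<Prod>n\<in>{\<mu><..<\<kappa>}. y (Suc m) n) * x (Suc m) \<kappa> * subset_weight x y {\<kappa><..N} S"
proof -
  let ?f = "\<lambda>n. if n \<in> insert \<kappa> S then x (tail_count (insert \<kappa> S) n) n
    else y (tail_count (insert \<kappa> S) n) n"
  have S: "S \<subseteq> {\<kappa><..N}" "finite S" "card S = m"
    using assms by (auto simp: k_subsets_def)
  have low: "tail_count (insert \<kappa> S) n = Suc m" if "n \<le> \<kappa>" for n
    using tail_count_insert_le[of S \<kappa> n] S that by (metis greaterThanAtMost_iff subset_iff)
  have I: "{\<mu><..N} = {\<mu><..<\<kappa>} \<union> insert \<kappa> {\<kappa><..N}"
    using assms by auto
  have "prod ?f {\<mu><..N} = prod ?f {\<mu><..<\<kappa>} * (?f \<kappa> * prod ?f {\<kappa><..N})"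
    unfolding I by (subst prod.union_disjoint) auto
  also have "prod ?f {\<mu><..<\<kappa>} = (\<Prod>n\<in>{\<mu><..<\<kappa>}. y (Suc m) n)"
    by (rule prod.cong) (use S low in auto)
  also have "?f \<kappa> = x (Suc m) \<kappa>"
    using low by simp
  also have "prod ?f {\<kappa><..N} = subset_weight x y {\<kappa><..N} S"
    unfolding subset_weight_def by (rule prod.cong) (auto simp: tail_count_insert_greater)
  finally show ?thesis
    by (simp add: subset_weight_def mult.assoc)
qed

section \<open>Row sums of products of strictly upper triangular matrices\<close>

text \<open>For \<open>m \<le> k\<close> this is the product of the last \<open>m\<close> factors.
  Counting from the right makes each induction step prepend a factor on the left, as
  \<open>foldr\<close> does.\<close>

definition tail_prod :: "nat \<Rightarrow> (nat \<Rightarrow> semi_inf_matrix) \<Rightarrow> nat \<Rightarrow> semi_inf_matrix" where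
  "tail_prod k A m = foldr semi_inf_mult (map A [k + 1 - m..<k + 1]) semi_inf_id"

lemma tail_prod_0 [simp]: "tail_prod k A 0 = semi_inf_id"
  by (simp add: tail_prod_def)

lemma tail_prod_full: "tail_prod k A k = semi_inf_prod k A"
  by (simp add: tail_prod_def semi_inf_prod_def)

lemma tail_prod_Suc:
  assumes "m < k"
  shows "tail_prod k A (Suc m) = semi_inf_mult (A (k - m)) (tail_prod k A m)"
proof -
  have "[k - m..<k + 1] = (k - m) # [k + 1 - m..<k + 1]"
    using assms by (subst upt_conv_Cons) (auto simp: Suc_diff_le)
  then show ?thesis
    by (simp add: tail_prod_def)
qed

context
  fixes k :: nat and A :: "nat \<Rightarrow> semi_inf_matrix"
  assumes strictly_upper: "\<And>i \<mu> \<nu>. \<nu> \<le> \<mu> \<Longrightarrow> A i \<mu> \<nu> = 0"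
begin

lemma tail_prod_upper: "m \<le> k \<Longrightarrow> \<nu> < \<mu> \<Longrightarrow> tail_prod k A m \<mu> \<nu> = 0"
proof (induction m arbitrary: \<mu>)
  case (Suc m)
  have "A (k - m) \<mu> \<kappa> * tail_prod k A m \<kappa> \<nu> = 0" for \<kappa>
    using Suc strictly_upper[of \<kappa> \<mu>] by (cases "\<kappa> \<le> \<mu>") auto
  then show ?case
    using Suc.prems by (simp only: tail_prod_Suc Suc_le_eq semi_inf_mult_def infsum_0)
qed (simp add: semi_inf_id_def)

text \<open>Terms with \<open>\<kappa> \<le> \<mu>\<close> vanish through the first factor, those
  with \<open>\<kappa> > N \<ge> \<nu>\<close> through the second. One bound \<open>N\<close> for
  all columns lets the sums over \<open>\<nu>\<close> and \<open>\<kappa>\<close> be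
  exchanged.\<close>

lemma tail_prod_Suc_sum:
  assumes "m < k" "\<nu> \<le> N"
  shows "tail_prod k A (Suc m) \<mu> \<nu> = (\<Sum>\<kappa>\<in>{\<mu><..N}. A (k - m) \<mu> \<kappa> * tail_prod k A m \<kappa> \<nu>)"
proof -
  have "(\<Sum>\<^sub>\<infinity>\<kappa>. A (k - m) \<mu> \<kappa> * tail_prod k A m \<kappa> \<nu>)
      = (\<Sum>\<^sub>\<infinity>\<kappa>\<in>{\<mu><..N}. A (k - m) \<mu> \<kappa> * tail_prod k A m \<kappa> \<nu>)"
    by (rule infsum_cong_neutral) (use assms tail_prod_upper strictly_upper in \<open>auto simp: not_less not_le\<close>)
  then show ?thesis
    using assms by (simp add: tail_prod_Suc semi_inf_mult_def)
qed

lemma tail_prod_Suc_row_sum: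
  assumes "m < k"
  shows "(\<Sum>\<nu>\<le>N. tail_prod k A (Suc m) \<mu> \<nu>)
       = (\<Sum>\<kappa>\<in>{\<mu><..N}. A (k - m) \<mu> \<kappa> * (\<Sum>\<nu>\<le>N. tail_prod k A m \<kappa> \<nu>))"
proof -
  have "(\<Sum>\<nu>\<le>N. tail_prod k A (Suc m) \<mu> \<nu>)
      = (\<Sum>\<nu>\<le>N. \<Sum>\<kappa>\<in>{\<mu><..N}. A (k - m) \<mu> \<kappa> * tail_prod k A m \<kappa> \<nu>)"
    by (rule sum.cong) (use assms tail_prod_Suc_sum in auto)
  also have "\<dots> = (\<Sum>\<kappa>\<in>{\<mu><..N}. \<Sum>\<nu>\<le>N. A (k - m) \<mu> \<kappa> * tail_prod k A m \<kappa> \<nu>)"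
    by (rule sum.swap)
  finally show ?thesis
    by (simp add: sum_distrib_left)
qed

lemma tail_prod_Suc_row_norm:
  assumes "m < k"
  shows "(\<Sum>\<nu>\<le>N. norm (tail_prod k A (Suc m) \<mu> \<nu>))
       \<le> (\<Sum>\<kappa>\<in>{\<mu><..N}. norm (A (k - m) \<mu> \<kappa>) * (\<Sum>\<nu>\<le>N. norm (tail_prod k A m \<kappa> \<nu>)))"
proof -
  have "(\<Sum>\<nu>\<le>N. norm (tail_prod k A (Suc m) \<mu> \<nu>))
      \<le> (\<Sum>\<nu>\<le>N. \<Sum>\<kappa>\<in>{\<mu><..N}. norm (A (k - m) \<mu> \<kappa>) * norm (tail_prod k A m \<kappa> \<nu>))"
  proof (rule sum_mono)
    fix \<nu> assume "\<nu> \<in> {..N}"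
    then show "norm (tail_prod k A (Suc m) \<mu> \<nu>)
        \<le> (\<Sum>\<kappa>\<in>{\<mu><..N}. norm (A (k - m) \<mu> \<kappa>) * norm (tail_prod k A m \<kappa> \<nu>))"
      using assms by (subst tail_prod_Suc_sum[of m \<nu> N])
        (auto intro!: sum_norm_le simp: norm_mult)
  qed
  also have "\<dots> = (\<Sum>\<kappa>\<in>{\<mu><..N}. \<Sum>\<nu>\<le>N. norm (A (k - m) \<mu> \<kappa>) * norm (tail_prod k A m \<kappa> \<nu>))"
    by (rule sum.swap)
  finally show ?thesis
    by (simp add: sum_distrib_left)
qed

end

section \<open>Row sums and row norms for the matrices \<open>B_mat\<close>\<close>

lemma B_mat_strictly_upper: "\<nu> \<le> \<mu> \<Longrightarrow> B_mat \<tau> k \<rho> \<xi> i \<mu> \<nu> = 0"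
  by (simp add: B_mat_def)

text \<open>Prepending a matrix corresponds to adding a new minimum to the subset: the elements of
  \<open>S\<close> are the successive indices of a path that starts at \<open>\<mu>\<close>. Cutting
  the columns at \<open>N\<close> cuts the subsets at \<open>N\<close>.\<close>

lemma B_mat_row_sum:
  assumes "m \<le> k" "\<mu> \<le> N"
  shows "(\<Sum>\<nu>\<le>N. tail_prod k (B_mat \<tau> k \<rho> \<xi>) m \<mu> \<nu>)
       = (\<Sum>S\<in>k_subsets m {\<mu><..N}.
            subset_weight (\<lambda>c n. \<xi> (k + 1 - c) powi (- int n) * complex_of_real (\<rho> n))
              (\<lambda>c n. complex_of_real (1 - \<rho> n + \<rho> n * \<tau> ^ c)) {\<mu><..N} S)"
    (is "_ = (\<Sum>S\<in>_. subset_weight ?x ?y _ S)")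
  using assms
proof (induction m arbitrary: \<mu>)
  \<comment> \<open>The empty set has weight \<open>1\<close>, because with tail count
    \<open>0\<close> each factor is \<open>1 - \<rho> n + \<rho> n\<close>. For the same reason
    positions beyond the maximum of a set never contribute. By \<open>\<mu> \<le> N\<close> the
    diagonal entry lies in the row sum.\<close>
  case 0
  then show ?case
    by (simp add: subset_weight_def semi_inf_id_def)
next
  case (Suc m)
  \<comment> \<open>For \<open>i = k - m\<close> the exponent \<open>k - i + 1\<close> in
    \<open>phi\<close> is \<open>m + 1\<close>, the tail count of all positions up to
    \<open>\<kappa>\<close>, and \<open>k + 1 - (m + 1)\<close> is again \<open>i\<close>.\<close>
  have entry: "B_mat \<tau> k \<rho> \<xi> (k - m) \<mu> \<kappa> = (\<Prod>n\<in>{\<mu><..<\<kappa>}. ?y (Suc m) n) * ?x (Suc m) \<kappa>"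
    if "\<kappa> \<in> {\<mu><..N}" for \<kappa>
    using that Suc.prems by (simp add: B_mat_def phi_def mult_ac)
  have "(\<Sum>\<nu>\<le>N. tail_prod k (B_mat \<tau> k \<rho> \<xi>) (Suc m) \<mu> \<nu>)
      = (\<Sum>\<kappa>\<in>{\<mu><..N}. B_mat \<tau> k \<rho> \<xi> (k - m) \<mu> \<kappa> * (\<Sum>\<nu>\<le>N. tail_prod k (B_mat \<tau> k \<rho> \<xi>) m \<kappa> \<nu>))"
    using Suc.prems by (intro tail_prod_Suc_row_sum B_mat_strictly_upper) auto
  also have "\<dots> = (\<Sum>\<kappa>\<in>{\<mu><..N}. \<Sum>S\<in>k_subsets m {\<kappa><..N}.
      subset_weight ?x ?y {\<mu><..N} (insert \<kappa> S))"
  proof (rule sum.cong)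
    fix \<kappa> assume \<kappa>: "\<kappa> \<in> {\<mu><..N}"
    then have "(\<Sum>\<nu>\<le>N. tail_prod k (B_mat \<tau> k \<rho> \<xi>) m \<kappa> \<nu>)
        = (\<Sum>S\<in>k_subsets m {\<kappa><..N}. subset_weight ?x ?y {\<kappa><..N} S)"
      using Suc by simp
    then show "B_mat \<tau> k \<rho> \<xi> (k - m) \<mu> \<kappa> * (\<Sum>\<nu>\<le>N. tail_prod k (B_mat \<tau> k \<rho> \<xi>) m \<kappa> \<nu>)
        = (\<Sum>S\<in>k_subsets m {\<kappa><..N}. subset_weight ?x ?y {\<mu><..N} (insert \<kappa> S))"
      by (simp only: entry[OF \<kappa>] sum_distrib_left)
        (rule sum.cong, simp_all only: subset_weight_insert_min[OF \<kappa>])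
  qed simp
  also have "\<dots> = (\<Sum>S\<in>k_subsets (Suc m) {\<mu><..N}. subset_weight ?x ?y {\<mu><..N} S)"
    by (rule sum_k_subsets_Suc[symmetric])
  finally show ?case .
qed

text \<open>Each \<open>phi\<close> is a convex combination of \<open>1\<close> and
  \<open>\<tau> ^ m\<close>, hence lies between \<open>0\<close> and \<open>T ^ m\<close>.\<close>

lemma norm_B_mat_le:
  assumes "\<And>n. n \<ge> 1 \<Longrightarrow> \<rho> n \<in> {0..1}" "0 \<le> \<tau>" "\<tau> \<le> T" "1 \<le> T" "norm (\<xi> i) = R" "\<mu> < \<nu>"
    "m = k - i + 1"
  shows "T ^ (m * \<mu>) * norm (B_mat \<tau> k \<rho> \<xi> i \<mu> \<nu>) \<le> T ^ (m * \<nu>) * inverse R ^ \<nu>"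
proof -
  have R: "0 \<le> R" using assms(5) by auto
  have \<rho>: "0 \<le> \<rho> n" "\<rho> n \<le> 1" if "\<mu> < n" for n
    using assms(1)[of n] that by auto
  have phi: "0 \<le> phi \<tau> k \<rho> i n \<and> phi \<tau> k \<rho> i n \<le> T ^ m" if "\<mu> < n" for n
  proof
    show "0 \<le> phi \<tau> k \<rho> i n"
      using \<rho>[OF that] assms(2) by (simp add: phi_def)
    have "\<tau> ^ m \<le> T ^ m" "1 \<le> T ^ m"
      using assms(2-4) by (auto intro: power_mono one_le_power)
    then have "(1 - \<rho> n) * 1 + \<rho> n * \<tau> ^ m \<le> (1 - \<rho> n) * T ^ m + \<rho> n * T ^ m"
      using \<rho>[OF that] by (intro add_mono mult_left_mono) auto
    then show "phi \<tau> k \<rho> i n \<le> T ^ m"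
      using assms(7) by (simp add: phi_def algebra_simps)
  qed
  have "(\<Prod>n\<in>{\<mu><..<\<nu>}. phi \<tau> k \<rho> i n) \<le> (\<Prod>n\<in>{\<mu><..<\<nu>}. T ^ m)"
    by (rule prod_mono) (use phi in auto)
  also have "\<dots> = T ^ (m * (\<nu> - Suc \<mu>))"
    by (simp add: power_mult)
  \<comment> \<open>One spare factor \<open>T ^ m \<ge> 1\<close> is added so that the exponents
    \<open>m * \<mu>\<close> and \<open>m * (\<nu> - \<mu>)\<close> add up to
    \<open>m * \<nu>\<close>.\<close>
  also have "\<dots> \<le> T ^ (m * (\<nu> - \<mu>))"
    using assms(4) by (intro power_increasing mult_le_mono) auto
  finally have prod: "(\<Prod>n\<in>{\<mu><..<\<nu>}. phi \<tau> k \<rho> i n) \<le> T ^ (m * (\<nu> - \<mu>))" .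
  have prod0: "0 \<le> (\<Prod>n\<in>{\<mu><..<\<nu>}. phi \<tau> k \<rho> i n)"
    by (rule prod_nonneg) (use phi in auto)
  have "norm (B_mat \<tau> k \<rho> \<xi> i \<mu> \<nu>) = inverse R ^ \<nu> * \<rho> \<nu> * (\<Prod>n\<in>{\<mu><..<\<nu>}. phi \<tau> k \<rho> i n)"
    using assms(5,6) \<rho>[of \<nu>] prod0
    by (simp add: B_mat_def norm_mult norm_inverse norm_power power_int_minus power_inverse
        flip: of_real_prod)
  also have "\<dots> \<le> inverse R ^ \<nu> * 1 * T ^ (m * (\<nu> - \<mu>))"
    using R \<rho>[of \<nu>] assms(6) prod prod0 by (intro mult_mono) auto
  finally have "T ^ (m * \<mu>) * norm (B_mat \<tau> k \<rho> \<xi> i \<mu> \<nu>)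
      \<le> T ^ (m * \<mu>) * (inverse R ^ \<nu> * T ^ (m * (\<nu> - \<mu>)))"
    using assms(4) by (intro mult_left_mono) auto
  also have "\<dots> = T ^ (m * \<mu> + m * (\<nu> - \<mu>)) * inverse R ^ \<nu>"
    by (simp add: power_add)
  also have "m * \<mu> + m * (\<nu> - \<mu>) = m * \<nu>"
    using assms(6) by (simp flip: distrib_left)
  finally show ?thesis .
qed

lemma sum_power_le_geometric:
  fixes r :: real
  assumes "0 \<le> r" "r < 1" "finite I"
  shows "(\<Sum>n\<in>I. r ^ n) \<le> 1 / (1 - r)"
  using sum_le_suminf[of "\<lambda>n. r ^ n" I] assms by (simp add: suminf_geometric summable_geometric)

text \<open>The factor \<open>T ^ (m * \<mu>)\<close> absorbs the growth of the products of \<open>phi\<close> that start at \<open>\<mu>\<close>.\<close>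

lemma B_mat_row_norm:
  assumes "\<And>n. n \<ge> 1 \<Longrightarrow> \<rho> n \<in> {0..1}" "0 \<le> \<tau>" "\<tau> \<le> T" "1 \<le> T" "T < R"
    "\<And>i. i \<in> {1..k} \<Longrightarrow> norm (\<xi> i) = R" "m \<le> k"
  shows "T ^ (m * \<mu>) * (\<Sum>\<nu>\<le>N. norm (tail_prod k (B_mat \<tau> k \<rho> \<xi>) m \<mu> \<nu>))
       \<le> (1 / (1 - T / R)) ^ m"
  using assms(7)
proof (induction m arbitrary: \<mu>)
  case 0
  have "(\<Sum>\<nu>\<le>N. norm (semi_inf_id \<mu> \<nu>)) = (\<Sum>\<nu>\<le>N. if \<mu> = \<nu> then 1 else 0)"
    by (rule sum.cong) (auto simp: semi_inf_id_def)
  then show ?case by simp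
next
  case (Suc m)
  let ?B = "B_mat \<tau> k \<rho> \<xi>" and ?D = "1 / (1 - T / R)"
  let ?Q = "\<lambda>\<kappa>. \<Sum>\<nu>\<le>N. norm (tail_prod k ?B m \<kappa> \<nu>)"
  have R: "0 < R" "0 \<le> T" using assms by auto
  have D: "0 \<le> ?D" using assms R by simp
  \<comment> \<open>Of \<open>T ^ (Suc m * \<kappa>)\<close>, one \<open>T ^ \<kappa>\<close> joins
    \<open>inverse R ^ \<kappa>\<close> to give a geometric term, and
    \<open>T ^ (m * \<kappa>)\<close> is the weight that the induction hypothesis requires.\<close>
  have step: "T ^ (Suc m * \<mu>) * (norm (?B (k - m) \<mu> \<kappa>) * ?Q \<kappa>) \<le> (T / R) ^ \<kappa> * ?D ^ m"
    if \<kappa>: "\<kappa> \<in> {\<mu><..N}" for \<kappa>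
  proof -
    have "T ^ (Suc m * \<mu>) * norm (?B (k - m) \<mu> \<kappa>) \<le> T ^ (Suc m * \<kappa>) * inverse R ^ \<kappa>"
      using \<kappa> Suc.prems assms by (intro norm_B_mat_le) auto
    then have "T ^ (Suc m * \<mu>) * norm (?B (k - m) \<mu> \<kappa>) * ?Q \<kappa> \<le> T ^ (Suc m * \<kappa>) * inverse R ^ \<kappa> * ?Q \<kappa>"
      by (intro mult_right_mono sum_nonneg) auto
    also have "\<dots> = (T / R) ^ \<kappa> * (T ^ (m * \<kappa>) * ?Q \<kappa>)"
      by (simp add: power_add divide_inverse power_mult_distrib)
    also have "\<dots> \<le> (T / R) ^ \<kappa> * ?D ^ m"
      using Suc R by (intro mult_left_mono) auto
    finally show ?thesis by (simp add: mult.assoc)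
  qed
  have "(\<Sum>\<nu>\<le>N. norm (tail_prod k ?B (Suc m) \<mu> \<nu>)) \<le> (\<Sum>\<kappa>\<in>{\<mu><..N}. norm (?B (k - m) \<mu> \<kappa>) * ?Q \<kappa>)"
    using Suc.prems by (intro tail_prod_Suc_row_norm B_mat_strictly_upper) auto
  then have "T ^ (Suc m * \<mu>) * (\<Sum>\<nu>\<le>N. norm (tail_prod k ?B (Suc m) \<mu> \<nu>))
      \<le> T ^ (Suc m * \<mu>) * (\<Sum>\<kappa>\<in>{\<mu><..N}. norm (?B (k - m) \<mu> \<kappa>) * ?Q \<kappa>)"
    using R by (intro mult_left_mono) auto
  also have "\<dots> \<le> (\<Sum>\<kappa>\<in>{\<mu><..N}. (T / R) ^ \<kappa> * ?D ^ m)"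
    by (subst sum_distrib_left) (intro sum_mono step)
  also have "\<dots> = (\<Sum>\<kappa>\<in>{\<mu><..N}. (T / R) ^ \<kappa>) * ?D ^ m"
    by (simp add: sum_distrib_right)
  also have "\<dots> \<le> ?D * ?D ^ m"
    using assms R D by (intro mult_right_mono sum_power_le_geometric) auto
  finally show ?case by simp
qed

section \<open>Expectation of products over independent events\<close>

text \<open>Expanding the product over subsets \<open>X\<close> of \<open>J\<close> leaves
  indicators of intersections, whose probabilities factor by independence; the same expansion read
  backwards gives the product on the right.\<close>

lemma (in prob_space) indep_events_prod_affine_indicator:
  fixes a b :: "'i \<Rightarrow> complex"
  assumes indep: "indep_events A I" and J: "J \<subseteq> I" "finite J"
  shows "integrable M (\<lambda>\<omega>. \<Prod>n\<in>J. a n + b n * indicator (A n) \<omega>)"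
    and "(LINT \<omega>|M. (\<Prod>n\<in>J. a n + b n * indicator (A n) \<omega>))
         = (\<Prod>n\<in>J. a n + b n * complex_of_real (prob (A n)))"
proof -
  \<comment> \<open>Intersecting with \<open>space M\<close> gives the sure event for
    \<open>X = {}\<close>, where the bare intersection would be \<open>UNIV\<close>.\<close>
  let ?E = "\<lambda>X. space M \<inter> (\<Inter>n\<in>X. A n)"
  have A: "A n \<in> events" if "n \<in> I" for n
    using indep that by (auto simp: indep_events_def)
  have E: "?E X \<in> events" if "X \<subseteq> J" for X
  proof (cases "X = {}")
    case False
    then have "(\<Inter>n\<in>X. A n) \<in> events"
      using that J A by (intro sets.finite_INT) (auto intro: finite_subset)
    then show ?thesis by auto
  qed auto
  have prob_E: "prob (?E X) = (\<Prod>n\<in>X. prob (A n))" if "X \<subseteq> J" for X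
  proof (cases "X = {}")
    case False
    moreover have "A n \<subseteq> space M" if "n \<in> X" for n
      using that \<open>X \<subseteq> J\<close> J A[THEN sets.sets_into_space] by blast
    ultimately have "?E X = (\<Inter>n\<in>X. A n)"
      by auto
    then show ?thesis
      using False that J indep unfolding indep_events_def by (metis finite_subset order_trans)
  qed (simp add: prob_space)
  have ind: "(\<Prod>n\<in>X. indicator (A n) \<omega> :: complex) = indicator (?E X) \<omega>"
    if "X \<subseteq> J" "\<omega> \<in> space M" for X \<omega>
  proof -
    have "finite X" using that J by (auto intro: finite_subset)
    then show ?thesis using that(2)
      by (induction X) (auto simp: indicator_def)
  qed
  have expand: "(\<Prod>n\<in>J. a n + b n * indicator (A n) \<omega>)
      = (\<Sum>X\<in>Pow J. (prod b X * prod a (J - X)) * indicator (?E X) \<omega>)"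
    if "\<omega> \<in> space M" for \<omega>
  proof -
    have "(\<Prod>n\<in>J. b n * indicator (A n) \<omega> + a n)
        = (\<Sum>X\<in>Pow J. (\<Prod>n\<in>X. b n * indicator (A n) \<omega>) * prod a (J - X))"
      by (rule prod_add) fact
    also have "\<dots> = (\<Sum>X\<in>Pow J. (prod b X * prod a (J - X)) * indicator (?E X) \<omega>)"
      by (rule sum.cong) (use that in \<open>auto simp: prod.distrib ind\<close>)
    finally show ?thesis by (simp add: add.commute)
  qed
  have bochner: "has_bochner_integral M (indicator (?E X)) (complex_of_real (prob (?E X)))"
    if "X \<subseteq> J" for X
  proof -
    have "has_bochner_integral M (\<lambda>\<omega>. indicator (?E X) \<omega> *\<^sub>R (1 :: complex)) (prob (?E X) *\<^sub>R 1)"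
      using E[OF that] by (intro has_bochner_integral_indicator) (simp_all add: emeasure_eq_measure)
    moreover have "(\<lambda>\<omega>. indicator (?E X) \<omega> *\<^sub>R (1 :: complex)) = indicator (?E X)"
      by (auto simp: indicator_def)
    ultimately show ?thesis by (simp add: scaleR_conv_of_real)
  qed
  have int: "has_bochner_integral M
      (\<lambda>\<omega>. \<Sum>X\<in>Pow J. (prod b X * prod a (J - X)) * indicator (?E X) \<omega>)
      (\<Sum>X\<in>Pow J. (prod b X * prod a (J - X)) * complex_of_real (prob (?E X)))"
    using bochner by (intro has_bochner_integral_sum has_bochner_integral_mult_right) auto
  have "(\<Sum>X\<in>Pow J. (prod b X * prod a (J - X)) * complex_of_real (prob (?E X)))
      = (\<Sum>X\<in>Pow J. (\<Prod>n\<in>X. b n * complex_of_real (prob (A n))) * prod a (J - X))"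
    by (rule sum.cong) (auto simp: prob_E prod.distrib)
  also have "\<dots> = (\<Prod>n\<in>J. b n * complex_of_real (prob (A n)) + a n)"
    by (rule prod_add[symmetric]) fact
  finally have "has_bochner_integral M
      (\<lambda>\<omega>. \<Sum>X\<in>Pow J. (prod b X * prod a (J - X)) * indicator (?E X) \<omega>)
      (\<Prod>n\<in>J. a n + b n * complex_of_real (prob (A n)))"
    using int by (simp add: add.commute)
  then have "has_bochner_integral M (\<lambda>\<omega>. \<Prod>n\<in>J. a n + b n * indicator (A n) \<omega>)
      (\<Prod>n\<in>J. a n + b n * complex_of_real (prob (A n)))"
    using expand by (subst has_bochner_integral_cong[OF refl _ refl]) auto
  then show "integrable M (\<lambda>\<omega>. \<Prod>n\<in>J. a n + b n * indicator (A n) \<omega>)"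
    and "(LINT \<omega>|M. (\<Prod>n\<in>J. a n + b n * indicator (A n) \<omega>))
         = (\<Prod>n\<in>J. a n + b n * complex_of_real (prob (A n)))"
    by (auto simp: has_bochner_integral_iff)
qed

section \<open>Size and convergence of the sum over subsets\<close>

text \<open>The pairs are grouped by their second component; elements of \<open>V\<close> beyond
  \<open>N\<close> lie in no pair.\<close>

lemma sigma_count_eq_sum_tail_count:
  fixes N :: nat
  assumes "S \<subseteq> {0<..N}" "V \<subseteq> {1..}"
  shows "sigma_count S V = (\<Sum>n\<in>V \<inter> {0<..N}. tail_count S n)"
proof -
  have fin: "finite S" by (rule finite_subset[OF assms(1)]) simp
  have "{(u, v). u \<in> S \<and> v \<in> V \<and> v \<le> u}
      = prod.swap ` (SIGMA n:V \<inter> {0<..N}. {s \<in> S. n \<le> s})"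
    using assms by (fastforce simp: image_iff)
  then show ?thesis
    using fin by (simp add: sigma_count_def card_image tail_count_def)
qed

text \<open>At most \<open>s\<close> positive integers are \<open>\<le> s\<close>. The bound does
  not involve \<open>V\<close>, which makes the later domination uniform over the random
  set.\<close>

lemma sigma_count_le_sum:
  assumes "finite S" "V \<subseteq> {1..}"
  shows "sigma_count S V \<le> (\<Sum>s\<in>S. s)"
proof -
  have "sigma_count S V \<le> card (SIGMA s:S. {1..s})"
    unfolding sigma_count_def using assms by (intro card_mono) auto
  then show ?thesis using assms by simp
qed

text \<open>Since \<open>\<tau>\<close> may be below \<open>1\<close>, it is first replaced by
  \<open>T \<ge> 1\<close>, whose powers grow with the exponent. All \<open>\<xi> i\<close> have
  norm \<open>R\<close>, so ranks no longer matter.\<close>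

lemma norm_subset_term_le:
  assumes "0 \<le> \<tau>" "\<tau> \<le> T" "1 \<le> T" "0 < R" "\<And>i. i \<in> {1..k} \<Longrightarrow> norm (\<xi> i) = R"
    "V \<subseteq> {1..}" "S \<in> k_subsets k V"
  shows "norm (subset_term \<tau> k \<xi> V S) \<le> (\<Prod>s\<in>S. (T / R) ^ s)"
proof -
  have S: "finite S" "card S = k"
    using assms by (auto simp: k_subsets_def)
  have "norm (\<Prod>i=1..k. \<xi> i powi (- int (nth_smallest S i)))
      = (\<Prod>i=1..k. inverse R ^ nth_smallest S i)"
    unfolding prod_norm[symmetric]
    by (rule prod.cong) (use assms(5) in \<open>auto simp: norm_inverse norm_power power_int_minus power_inverse\<close>)
  also have "\<dots> = (\<Prod>s\<in>S. inverse R ^ s)"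
    using prod_nth_smallest[OF S, of "\<lambda>i s. inverse R ^ s"] by simp
  finally have xi: "norm (\<Prod>i=1..k. \<xi> i powi (- int (nth_smallest S i))) = (\<Prod>s\<in>S. inverse R ^ s)" .
  have "\<tau> ^ sigma_count S V \<le> T ^ sigma_count S V"
    using assms by (intro power_mono) auto
  also have "\<dots> \<le> T ^ (\<Sum>s\<in>S. s)"
    using assms S by (intro power_increasing sigma_count_le_sum) auto
  also have "\<dots> = (\<Prod>s\<in>S. T ^ s)"
    by (simp add: power_sum)
  finally have "\<tau> ^ sigma_count S V * (\<Prod>s\<in>S. inverse R ^ s) \<le> (\<Prod>s\<in>S. T ^ s) * (\<Prod>s\<in>S. inverse R ^ s)"
    using assms by (intro mult_right_mono prod_nonneg) auto
  then show ?thesis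
    using assms(1) unfolding subset_term_def norm_mult norm_power xi
    by (simp add: divide_inverse power_mult_distrib prod.distrib)
qed

text \<open>Enlarging \<open>F\<close> to all subsets of its union turns the sum into the product of
  \<open>1 + r ^ s\<close>, and \<open>1 + x \<le> exp x\<close> reduces it to a geometric
  series.\<close>

lemma sum_prod_power_le:
  fixes r :: real
  assumes r: "0 \<le> r" "r < 1" and F: "finite F" "\<And>S. S \<in> F \<Longrightarrow> finite S"
  shows "(\<Sum>S\<in>F. \<Prod>s\<in>S. r ^ s) \<le> exp (1 / (1 - r))"
proof -
  have fin: "finite (\<Union>F)" using F by auto
  have "(\<Sum>S\<in>F. \<Prod>s\<in>S. r ^ s) \<le> (\<Sum>S\<in>Pow (\<Union>F). \<Prod>s\<in>S. r ^ s)"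
    using fin r by (intro sum_mono2 prod_nonneg) auto
  also have "\<dots> = (\<Prod>s\<in>\<Union>F. r ^ s + 1)"
    using prod_add[OF fin, of "\<lambda>s. r ^ s" "\<lambda>_. 1"] by simp
  also have "\<dots> \<le> (\<Prod>s\<in>\<Union>F. exp (r ^ s))"
    using r by (intro prod_mono) (auto simp: add.commute[of _ 1])
  also have "\<dots> = exp (\<Sum>s\<in>\<Union>F. r ^ s)"
    using fin by (simp add: exp_sum)
  also have "\<dots> \<le> exp (1 / (1 - r))"
    using sum_power_le_geometric[OF r fin] by simp
  finally show ?thesis .
qed

text \<open>Any finite family of finite sets fits into one interval \<open>{0<..N}\<close>. Hence
  the unordered sum over all subsets is the limit of a sequence of truncations, as dominated
  convergence requires.\<close>

lemma filterlim_k_subsets: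
  "filterlim (\<lambda>N. k_subsets k (V \<inter> {0<..N})) (finite_subsets_at_top (k_subsets k V)) sequentially"
  if "V \<subseteq> {1..}" for V :: "nat set"
  unfolding filterlim_iff eventually_finite_subsets_at_top
proof safe
  fix P X
  assume X: "finite X" "X \<subseteq> k_subsets k V"
    and P: "\<forall>Y. finite Y \<and> X \<subseteq> Y \<and> Y \<subseteq> k_subsets k V \<longrightarrow> P Y"
  have "finite (\<Union>X)" using X by (auto simp: k_subsets_def)
  then obtain N0 where N0: "\<Union>X \<subseteq> {..N0}"
    using finite_nat_iff_bounded_le by blast
  show "\<forall>\<^sub>F N in sequentially. P (k_subsets k (V \<inter> {0<..N}))"
    using eventually_ge_at_top[of N0]
  proof eventually_elim
    fix N assume "N0 \<le> N"
    have "X \<subseteq> k_subsets k (V \<inter> {0<..N})"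
    proof
      fix S assume S: "S \<in> X"
      then have "S \<subseteq> V" "finite S" "card S = k" using X by (auto simp: k_subsets_def)
      moreover have "S \<subseteq> {0<..N}"
      proof
        fix s assume "s \<in> S"
        then have "s \<le> N0" "s \<in> {1..}" using S N0 \<open>S \<subseteq> V\<close> that by auto
        then show "s \<in> {0<..N}" using \<open>N0 \<le> N\<close> by auto
      qed
      ultimately show "S \<in> k_subsets k (V \<inter> {0<..N})"
        by (simp add: k_subsets_def)
    qed
    moreover have "k_subsets k (V \<inter> {0<..N}) \<subseteq> k_subsets k V"
      by (auto simp: k_subsets_def)
    ultimately show "P (k_subsets k (V \<inter> {0<..N}))"
      using P finite_k_subsets[of "V \<inter> {0<..N}" k] by simp
  qed
qed

section \<open>The term of one subset, before and after taking the expectation\<close>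

text \<open>The factor at \<open>n\<close> is affine in the indicator of \<open>n \<in> V\<close>.
  For \<open>n \<in> S\<close> it is \<open>\<tau> ^ tail_count S n\<close> or \<open>0\<close>,
  which enforces \<open>S \<subseteq> V\<close>; for other \<open>n\<close> it is that power or
  \<open>1\<close>.\<close>

lemma subset_term_eq_prod:
  assumes V: "V \<subseteq> {1..}" and S: "S \<in> k_subsets k {0<..N}"
  shows "(\<Prod>s\<in>S. \<xi> (k + 1 - tail_count S s) powi (- int s)) *
      (\<Prod>n\<in>{0<..N}. (if n \<in> S then 0 else 1) +
         (complex_of_real \<tau> ^ tail_count S n - (if n \<in> S then 0 else 1)) * (if n \<in> V then 1 else 0))
    = (if S \<subseteq> V then subset_term \<tau> k \<xi> V S else 0)"
    (is "?c * prod ?f _ = _")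
proof (cases "S \<subseteq> V")
  case True
  have S': "S \<subseteq> {0<..N}" "finite S" "card S = k"
    using S by (auto simp: k_subsets_def)
  have "prod ?f {0<..N} = (\<Prod>n\<in>{0<..N}. if n \<in> V then complex_of_real \<tau> ^ tail_count S n else 1)"
    by (rule prod.cong) (use True in auto)
  also have "\<dots> = (\<Prod>n\<in>V \<inter> {0<..N}. complex_of_real \<tau> ^ tail_count S n)"
    by (subst prod.inter_restrict[symmetric]) (auto simp: Int_commute)
  also have "\<dots> = complex_of_real \<tau> ^ sigma_count S V"
    using S' V by (simp add: sigma_count_eq_sum_tail_count power_sum)
  finally show ?thesis
    using True prod_nth_smallest[OF S'(2,3), of "\<lambda>i s. \<xi> i powi (- int s)"]
    by (simp add: subset_term_def mult.commute)
next
  case False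
  then obtain s where "s \<in> S" "s \<notin> V" by auto
  then have "prod ?f {0<..N} = 0"
    using S by (intro prod_zero) (auto simp: k_subsets_def intro!: bexI[of _ s])
  with False show ?thesis by simp
qed

text \<open>With \<open>\<rho> n\<close> in place of the indicator, factors off \<open>S\<close>
  already agree with the weight. Those on \<open>S\<close> carry an extra
  \<open>\<tau> ^ tail_count S n\<close>, and these powers form the prefactor.\<close>

lemma subset_weight_pull_out:
  assumes "S \<in> k_subsets k {0<..N}"
  shows "(\<Prod>s\<in>S. \<xi> (k + 1 - tail_count S s) powi (- int s)) *
      (\<Prod>n\<in>{0<..N}. (if n \<in> S then 0 else 1) +
         (complex_of_real \<tau> ^ tail_count S n - (if n \<in> S then 0 else 1)) * complex_of_real (\<rho> n))
    = complex_of_real \<tau> ^ (k * (k + 1) div 2) *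
      subset_weight (\<lambda>c n. \<xi> (k + 1 - c) powi (- int n) * complex_of_real (\<rho> n))
        (\<lambda>c n. complex_of_real (1 - \<rho> n + \<rho> n * \<tau> ^ c)) {0<..N} S"
proof -
  have S: "S \<subseteq> {0<..N}" "finite S" "card S = k"
    using assms by (auto simp: k_subsets_def)
  have restrict: "prod f S = (\<Prod>n\<in>{0<..N}. if n \<in> S then f n else 1)" for f :: "nat \<Rightarrow> complex"
    using S by (simp add: prod.If_cases Int_absorb1)
  have "complex_of_real \<tau> ^ (k * (k + 1) div 2) = (\<Prod>s\<in>S. complex_of_real \<tau> ^ tail_count S s)"
    using sum_tail_count[OF S(2)] S(3) by (simp flip: power_sum)
  then show ?thesis
    unfolding subset_weight_def
    by (simp only: restrict prod.distrib[symmetric]) (rule prod.cong, auto simp: algebra_simps)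
qed

section \<open>A lower bound for the radius\<close>

text \<open>Turns the nonvanishing hypothesis into the size bound behind all convergence:
  \<open>R\<close> exceeds both \<open>1\<close> and \<open>\<tau>\<close>.\<close>

lemma radius_gt:
  fixes p q \<tau> R :: real
  assumes "p \<ge> 0" "q \<ge> 0" "p + q = 1" "q \<noteq> 0" "\<tau> = p / q"
    and nz: "\<And>z z' :: complex. cmod z \<ge> R \<Longrightarrow> cmod z' \<ge> R \<Longrightarrow>
           complex_of_real p + complex_of_real q * z * z' - z \<noteq> 0"
  shows "R > 1 + \<tau>"
proof (rule ccontr)
  assume "\<not> R > 1 + \<tau>"
  then have le: "R \<le> 1 + \<tau>" by simp
  have pos: "\<tau> \<ge> 0" "q * (1 + \<tau>) = 1"
    using assms(1-5) by (simp_all add: distrib_left)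
  text \<open>For \<open>z = - (1 + \<tau>)\<close> the equation \<open>p + q z z' = z\<close> is solved by \<open>z' = 1 + \<tau> + p\<close>.\<close>
  have "cmod (complex_of_real (-(1 + \<tau>))) \<ge> R" "cmod (complex_of_real (1 + \<tau> + p)) \<ge> R"
    using le pos assms(1) by (simp_all only: norm_of_real)
  moreover have "p + q * (-(1 + \<tau>)) * (1 + \<tau> + p) - (-(1 + \<tau>)) = 0"
    by (simp only: mult_minus_right mult_minus_left pos(2)) simp
  then have "complex_of_real p + complex_of_real q * complex_of_real (-(1 + \<tau>)) * complex_of_real (1 + \<tau> + p)
      - complex_of_real (-(1 + \<tau>)) = 0"
    by (metis of_real_0 of_real_add of_real_diff of_real_mult)
  ultimately show False using nz by blast
qed

section \<open>Dominated convergence for the truncated sums\<close>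

theorem mainTheorem3:
  fixes p q \<tau> R :: real
    and \<rho> :: "nat \<Rightarrow> real"
    and M :: "'w measure"
    and Y :: "'w \<Rightarrow> nat set"
    and k :: nat
    and \<xi> :: "nat \<Rightarrow> complex"
  assumes "p \<ge> 0" and "q \<ge> 0" and "p + q = 1" and "q \<noteq> 0"
    and "\<tau> = p / q"
    and "\<And>z z' :: complex. cmod z \<ge> R \<Longrightarrow> cmod z' \<ge> R \<Longrightarrow>
           complex_of_real p + complex_of_real q * z * z' - z \<noteq> 0"
    and "\<And>n. n \<ge> 1 \<Longrightarrow> \<rho> n \<in> {0..1}"
    and "bernoulli_random_set M \<rho> Y"
    and "k \<ge> 1"
    and "\<And>i. i \<in> {1..k} \<Longrightarrow> \<xi> i \<in> sphere 0 R"
  shows "(\<forall>\<omega>\<in>space M. subset_term \<tau> k \<xi> (Y \<omega>) summable_on k_subsets k (Y \<omega>)) \<and>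
     integrable M (\<lambda>\<omega>. \<Sum>\<^sub>\<infinity>S\<in>k_subsets k (Y \<omega>). subset_term \<tau> k \<xi> (Y \<omega>) S) \<and>
     (\<lambda>\<nu>. semi_inf_prod k (B_mat \<tau> k \<rho> \<xi>) 0 \<nu>) summable_on UNIV \<and>
     (LINT \<omega>|M. (\<Sum>\<^sub>\<infinity>S\<in>k_subsets k (Y \<omega>). subset_term \<tau> k \<xi> (Y \<omega>) S)) =
       complex_of_real \<tau> ^ (k * (k + 1) div 2) *
       (\<Sum>\<^sub>\<infinity>\<nu>. semi_inf_prod k (B_mat \<tau> k \<rho> \<xi>) 0 \<nu>)"
proof -
  interpret prob_space M
    using assms(8) by (simp add: bernoulli_random_set_def)
  have Y: "Y \<omega> \<subseteq> {1..}" if "\<omega> \<in> space M" for \<omega>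
    using assms(8) that by (simp add: bernoulli_random_set_def)
  let ?A = "\<lambda>n. {\<omega> \<in> space M. n \<in> Y \<omega>}"
  have indep: "indep_events ?A {1..}" and prob: "\<And>n. n \<ge> 1 \<Longrightarrow> prob (?A n) = \<rho> n"
    using assms(8) by (auto simp: bernoulli_random_set_def)
  \<comment> \<open>\<open>T\<close> dominates \<open>\<tau>\<close>, has increasing powers and
    stays below \<open>R\<close>. The constant \<open>C\<close> is free of \<open>\<omega>\<close>
    and of the truncation, so it serves as integrable majorant on a probability space.\<close>
  define T where "T = max 1 \<tau>"
  define C where "C = exp (1 / (1 - T / R))"
  have "\<tau> \<ge> 0" using assms by simp
  have "R > 1 + \<tau>" by (rule radius_gt[OF assms(1-6)])
  then have T: "\<tau> \<le> T" "1 \<le> T" "T < R" "0 < R" "0 \<le> T / R" "T / R < 1"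
    using \<open>\<tau> \<ge> 0\<close> by (auto simp: T_def)
  have xi: "norm (\<xi> i) = R" if "i \<in> {1..k}" for i
    using assms(10)[OF that] by simp
  let ?t = "\<lambda>\<omega>. subset_term \<tau> k \<xi> (Y \<omega>)"
  let ?P = "semi_inf_prod k (B_mat \<tau> k \<rho> \<xi>) 0"

  have bound: "(\<Sum>S\<in>F. norm (?t \<omega> S)) \<le> C"
    if "\<omega> \<in> space M" "finite F" "F \<subseteq> k_subsets k (Y \<omega>)" for \<omega> F
  proof -
    have "(\<Sum>S\<in>F. norm (?t \<omega> S)) \<le> (\<Sum>S\<in>F. \<Prod>s\<in>S. (T / R) ^ s)"
      using that Y T \<open>\<tau> \<ge> 0\<close> xi by (intro sum_mono norm_subset_term_le) auto
    also have "\<dots> \<le> C"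
      unfolding C_def using that T by (intro sum_prod_power_le) (auto simp: k_subsets_def)
    finally show ?thesis .
  qed
  have summable: "?t \<omega> summable_on k_subsets k (Y \<omega>)" if "\<omega> \<in> space M" for \<omega>
    by (rule abs_summable_summable, rule nonneg_bdd_above_summable_on)
      (auto intro!: bdd_aboveI2 bound that)

  define c where "c S = (\<Prod>s\<in>S. \<xi> (k + 1 - tail_count S s) powi (- int s))" for S
  define a where "a S n = (if n \<in> S then 0 else 1 :: complex)" for S and n :: nat
  define b where "b S n = complex_of_real \<tau> ^ tail_count S n - a S n" for S n
  \<comment> \<open>The index set is deterministic; \<open>Y\<close> enters only through indicators.
    This gives measurability and makes the independence lemma applicable term by term.\<close>
  define F where "F N \<omega> = (\<Sum>S\<in>k_subsets k {0<..N}. c S * (\<Prod>n\<in>{0<..N}. a S n + b S n * indicator (?A n) \<omega>))"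
    for N \<omega>
  have F_eq: "F N \<omega> = (\<Sum>S\<in>k_subsets k (Y \<omega> \<inter> {0<..N}). ?t \<omega> S)" if "\<omega> \<in> space M" for N \<omega>
  proof -
    have "F N \<omega> = (\<Sum>S\<in>k_subsets k {0<..N}. if S \<subseteq> Y \<omega> then ?t \<omega> S else 0)"
      unfolding F_def
    proof (rule sum.cong)
      fix S assume "S \<in> k_subsets k {0<..N}"
      from subset_term_eq_prod[OF Y[OF that] this, of \<xi> \<tau>]
      show "c S * (\<Prod>n\<in>{0<..N}. a S n + b S n * indicator (?A n) \<omega>)
          = (if S \<subseteq> Y \<omega> then ?t \<omega> S else 0)"
        using that by (simp only: a_def b_def c_def indicator_def of_bool_def mem_Collect_eq simp_thms)
    qed simp
    also have "\<dots> = (\<Sum>S\<in>{S \<in> k_subsets k {0<..N}. S \<subseteq> Y \<omega>}. ?t \<omega> S)"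
      by (rule sum.inter_filter[symmetric]) (simp add: finite_k_subsets)
    also have "{S \<in> k_subsets k {0<..N}. S \<subseteq> Y \<omega>} = k_subsets k (Y \<omega> \<inter> {0<..N})"
      by (auto simp: k_subsets_def)
    finally show ?thesis .
  qed
  have F_int: "integrable M (F N)" for N
    unfolding F_def
    by (intro Bochner_Integration.integrable_sum integrable_mult_right
        indep_events_prod_affine_indicator(1)[OF indep]) auto
  have F_expect: "(LINT \<omega>|M. F N \<omega>) = complex_of_real \<tau> ^ (k * (k + 1) div 2) * (\<Sum>\<nu>\<le>N. ?P \<nu>)" for N
  proof -
    have "(LINT \<omega>|M. F N \<omega>) = (\<Sum>S\<in>k_subsets k {0<..N}. c S *
        (LINT \<omega>|M. (\<Prod>n\<in>{0<..N}. a S n + b S n * indicator (?A n) \<omega>)))"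
      unfolding F_def
      by (subst Bochner_Integration.integral_sum)
        (auto intro!: integrable_mult_right indep_events_prod_affine_indicator(1)[OF indep])
    also have "\<dots> = (\<Sum>S\<in>k_subsets k {0<..N}. c S *
        (\<Prod>n\<in>{0<..N}. a S n + b S n * complex_of_real (\<rho> n)))"
      by (subst indep_events_prod_affine_indicator(2)[OF indep]) (auto simp: prob)
    also have "\<dots> = (\<Sum>S\<in>k_subsets k {0<..N}. complex_of_real \<tau> ^ (k * (k + 1) div 2) *
      subset_weight (\<lambda>c n. \<xi> (k + 1 - c) powi (- int n) * complex_of_real (\<rho> n))
        (\<lambda>c n. complex_of_real (1 - \<rho> n + \<rho> n * \<tau> ^ c)) {0<..N} S)"
      unfolding a_def b_def c_def by (rule sum.cong) (simp_all only: subset_weight_pull_out)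
    also have "\<dots> = complex_of_real \<tau> ^ (k * (k + 1) div 2) * (\<Sum>\<nu>\<le>N. ?P \<nu>)"
      using B_mat_row_sum[of k k 0 N \<tau> \<rho> \<xi>] by (simp add: tail_prod_full flip: sum_distrib_left)
    finally show ?thesis .
  qed
  have F_lim: "(\<lambda>N. F N \<omega>) \<longlonglongrightarrow> (\<Sum>\<^sub>\<infinity>S\<in>k_subsets k (Y \<omega>). ?t \<omega> S)" if "\<omega> \<in> space M" for \<omega>
    using filterlim_compose[OF _ filterlim_k_subsets[OF Y[OF that]]]
      has_sum_infsum[OF summable[OF that]]
    by (simp add: F_eq[OF that] has_sum_def)
  have F_bound: "norm (F N \<omega>) \<le> C" if "\<omega> \<in> space M" for N \<omega>
    unfolding F_eq[OF that]
    by (rule order_trans[OF norm_sum bound[OF that]]) (auto simp: finite_k_subsets, auto simp: k_subsets_def)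
  have F_meas: "F N \<in> borel_measurable M" for N
    using F_int by (rule borel_measurable_integrable)
  \<comment> \<open>The sum ranges over a random family of sets, so its measurability is obtained
    from the pointwise limit of the \<open>F N\<close>.\<close>
  have G_meas: "(\<lambda>\<omega>. \<Sum>\<^sub>\<infinity>S\<in>k_subsets k (Y \<omega>). ?t \<omega> S) \<in> borel_measurable M"
    by (rule borel_measurable_LIMSEQ_metric[OF F_meas F_lim])
  have AE_lim: "AE \<omega> in M. (\<lambda>N. F N \<omega>) \<longlonglongrightarrow> (\<Sum>\<^sub>\<infinity>S\<in>k_subsets k (Y \<omega>). ?t \<omega> S)"
    by (rule AE_I2) (rule F_lim)
  have AE_bound: "AE \<omega> in M. norm (F N \<omega>) \<le> C" for N
    by (rule AE_I2) (rule F_bound)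
  note dominated = G_meas F_meas integrable_const[of C] AE_lim AE_bound

  \<comment> \<open>In row \<open>0\<close> the weight \<open>T ^ (k * 0)\<close> is
    \<open>1\<close>, so the weighted estimate bounds the norms themselves.\<close>
  have P_bound: "(\<Sum>\<nu>\<in>X. norm (?P \<nu>)) \<le> (1 / (1 - T / R)) ^ k" if X: "finite X" for X
  proof -
    obtain N where "X \<subseteq> {..N}" using X finite_nat_iff_bounded_le by blast
    then have "(\<Sum>\<nu>\<in>X. norm (?P \<nu>)) \<le> (\<Sum>\<nu>\<le>N. norm (?P \<nu>))"
      by (intro sum_mono2) auto
    also have "\<dots> \<le> (1 / (1 - T / R)) ^ k"
      using B_mat_row_norm[of \<rho> \<tau> T R k \<xi> k 0 N] assms(7) T \<open>\<tau> \<ge> 0\<close> xi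
      by (simp add: tail_prod_full)
    finally show ?thesis .
  qed
  have P_summable: "?P summable_on UNIV"
    by (rule abs_summable_summable, rule nonneg_bdd_above_summable_on)
      (auto intro!: bdd_aboveI2 P_bound)
  then have "(\<lambda>N. \<Sum>\<nu>\<le>N. ?P \<nu>) \<longlonglongrightarrow> (\<Sum>\<^sub>\<infinity>\<nu>. ?P \<nu>)"
    using has_sum_imp_sums[OF has_sum_infsum] by (simp add: sums_def_le)
  then have "(\<lambda>N. LINT \<omega>|M. F N \<omega>)
      \<longlonglongrightarrow> complex_of_real \<tau> ^ (k * (k + 1) div 2) * (\<Sum>\<^sub>\<infinity>\<nu>. ?P \<nu>)"
    unfolding F_expect by (intro tendsto_mult_left)
  moreover have "(\<lambda>N. LINT \<omega>|M. F N \<omega>) \<longlonglongrightarrow> (LINT \<omega>|M. (\<Sum>\<^sub>\<infinity>S\<in>k_subsets k (Y \<omega>). ?t \<omega> S))"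
    by (rule integral_dominated_convergence[OF dominated])
  ultimately have "(LINT \<omega>|M. (\<Sum>\<^sub>\<infinity>S\<in>k_subsets k (Y \<omega>). ?t \<omega> S))
      = complex_of_real \<tau> ^ (k * (k + 1) div 2) * (\<Sum>\<^sub>\<infinity>\<nu>. ?P \<nu>)"
    by (rule LIMSEQ_unique[rotated])
  moreover have "integrable M (\<lambda>\<omega>. \<Sum>\<^sub>\<infinity>S\<in>k_subsets k (Y \<omega>). ?t \<omega> S)"
    by (rule integrable_dominated_convergence[OF dominated])
  ultimately show ?thesis
    using summable P_summable by (intro conjI ballI)
qed

end
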